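(* Let $m\ge 1$ independent events be given, event $\ell$ having outcomes $\{1,\dots,n_\ell\}$, probabilities $p_{\ell i}>0$ with $\sum_{i} p_{\ell i}=1$, and prices $\pi_{\ell i}>0$, and let $U$ be an admissible utility. Put $r_{\ell i}:=p_{\ell i}/\pi_{\ell i}$ and assume that each event is sorted so that $r_{\ell 1}\ge r_{\ell 2}\ge\cdots\ge r_{\ell n_\ell}$. Let $(c,g)$ solve the simultaneous problem of maximizing $\Phi$ over all feasible portfolios, with $c>0$. Then for each event $\ell$ there exists an integer $k_\ell\in\{0,1,\dots,n_\ell\}$ such that $$g_{\ell i}>0\ \text{ for } i\le k_\ell,\qquad g_{\ell i}=0\ \text{ for } i>k_\ell.$$ Moreover, $$r_{\ell,k_\ell+1}\le\frac{1-P_{\ell,k_\ell}}{1-Q_{\ell,k_\ell}}\qquad(k_\ell<n_\ell),$$ where $P_{\ell,k}:=\sum_{i\le k}p_{\ell i}$ and $Q_{\ell,k}:=\sum_{i\le k}\pi_{\ell i}$, and the exact support $\{i:g_{\ell i}>0\}$ of event $\ell$ is the same support obtained by solving the corresponding single-event problem with the same probabilities and prices. Hence the exact support of the simultaneous problem is the eventwise union of the single-event supports.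
   Context: An admissible utility is a function $U:(0,\infty)\to\mathbb{R}$ that is $C^1$, satisfies $U'(w)>0$ for all $w>0$, and is strictly concave. The random product-state is $X=(X_1,\dots,X_m)$ with $X_1,\dots,X_m$ independent and $\mathbb{P}(X_\ell=i)=p_{\ell i}$. A feasible portfolio is a pair $(c,g)$ with $c\ge 0$, $g_{\ell i}\ge 0$ for all $\ell,i$, satisfying the budget constraint $c+\sum_{\ell=1}^m\sum_{i=1}^{n_\ell}\pi_{\ell i}g_{\ell i}=1$ and such that the terminal wealth $W(x):=c+\sum_{\ell=1}^m g_{\ell,x_\ell}$ is strictly positive for every product-state $x$. The objective is $\Phi(c,g):=\mathbb{E}[U(W(X))]$. The single-event problem corresponding to event $\ell$ is the case $m=1$ of this problem with data $(p_{\ell i})_i,(\pi_{\ell i})_i$: maximize $\sum_{i} p_{\ell i}\,U(c'+g'_i)$ over $c'\ge 0$, $g'_i\ge 0$ with $c'+\sum_i\pi_{\ell i} g'_i=1$ and $c'+g'_i>0$ for all $i$; its support is the set of $i$ with $g'_i>0$ at the optimum.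
   Formalization: The support claims assume the single-event problem has an optimum, which can fail; when an event's prices sum to 1 its single-event support is not unique, so there the support of g is only shown to be one of the single-event supports (equality otherwise); likewise for the union. *)

theory Defs
  imports "HOL-Probability.Probability"
begin

definition strictly_concave_on :: "real set \<Rightarrow> (real \<Rightarrow> real) \<Rightarrow> bool" where
  "strictly_concave_on S f \<longleftrightarrow> convex S \<and>
     (\<forall>x\<in>S. \<forall>y\<in>S. \<forall>t. x \<noteq> y \<and> 0 < t \<and> t < 1 \<longrightarrow>
        (1 - t) * f x + t * f y < f ((1 - t) * x + t * y))"

definition admissible_utility :: "(real \<Rightarrow> real) \<Rightarrow> bool" where
  "admissible_utility U \<longleftrightarrow>
     U C1_differentiable_on {0<..} \<and> (\<forall>w>0. deriv U w > 0) \<and> strictly_concave_on {0<..} U"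

text \<open>Events are numbered by \<open>{1..m}\<close> and the outcomes of event \<open>l\<close> by \<open>{1..n l}\<close>; values of
  \<open>p\<close>, \<open>\<pi>\<close>, \<open>g\<close> outside these ranges never matter.\<close>

definition wealth :: "nat \<Rightarrow> real \<Rightarrow> (nat \<Rightarrow> nat \<Rightarrow> real) \<Rightarrow> (nat \<Rightarrow> nat) \<Rightarrow> real" where
  "wealth m c g x = c + (\<Sum>l=1..m. g l (x l))"

definition feasible ::
  "nat \<Rightarrow> (nat \<Rightarrow> nat) \<Rightarrow> (nat \<Rightarrow> nat \<Rightarrow> real) \<Rightarrow> real \<Rightarrow> (nat \<Rightarrow> nat \<Rightarrow> real) \<Rightarrow> bool" where
  "feasible m n \<pi> c g \<longleftrightarrow>
     c \<ge> 0 \<and> (\<forall>l\<in>{1..m}. \<forall>i\<in>{1..n l}. g l i \<ge> 0) \<and>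
     c + (\<Sum>l=1..m. \<Sum>i=1..n l. \<pi> l i * g l i) = 1 \<and>
     (\<forall>x \<in> (\<Pi>\<^sub>E l\<in>{1..m}. {1..n l}). wealth m c g x > 0)"

definition expected_utility ::
  "'a measure \<Rightarrow> (nat \<Rightarrow> 'a \<Rightarrow> nat) \<Rightarrow> (real \<Rightarrow> real) \<Rightarrow> nat \<Rightarrow>
   real \<Rightarrow> (nat \<Rightarrow> nat \<Rightarrow> real) \<Rightarrow> real" where
  "expected_utility M X U m c g = (\<integral>\<omega>. U (wealth m c g (\<lambda>l. X l \<omega>)) \<partial>M)"

definition optimal ::
  "'a measure \<Rightarrow> (nat \<Rightarrow> 'a \<Rightarrow> nat) \<Rightarrow> (real \<Rightarrow> real) \<Rightarrow> nat \<Rightarrow> (nat \<Rightarrow> nat) \<Rightarrow>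
   (nat \<Rightarrow> nat \<Rightarrow> real) \<Rightarrow> real \<Rightarrow> (nat \<Rightarrow> nat \<Rightarrow> real) \<Rightarrow> bool" where
  "optimal M X U m n \<pi> c g \<longleftrightarrow>
     is_arg_max (\<lambda>(c, g). expected_utility M X U m c g) (\<lambda>(c, g). feasible m n \<pi> c g) (c, g)"

definition support :: "nat \<Rightarrow> (nat \<Rightarrow> real) \<Rightarrow> nat set" where
  "support N g = {i \<in> {1..N}. g i > 0}"

definition single_feasible :: "nat \<Rightarrow> (nat \<Rightarrow> real) \<Rightarrow> real \<Rightarrow> (nat \<Rightarrow> real) \<Rightarrow> bool" where
  "single_feasible N \<pi> c g \<longleftrightarrow>
     c \<ge> 0 \<and> (\<forall>i\<in>{1..N}. g i \<ge> 0) \<and> c + (\<Sum>i=1..N. \<pi> i * g i) = 1 \<and>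
     (\<forall>i\<in>{1..N}. c + g i > 0)"

definition single_optimal ::
  "(real \<Rightarrow> real) \<Rightarrow> nat \<Rightarrow> (nat \<Rightarrow> real) \<Rightarrow> (nat \<Rightarrow> real) \<Rightarrow> real \<Rightarrow> (nat \<Rightarrow> real) \<Rightarrow> bool" where
  "single_optimal U N p \<pi> c g \<longleftrightarrow>
     is_arg_max (\<lambda>(c, g). \<Sum>i=1..N. p i * U (c + g i))
       (\<lambda>(c, g). single_feasible N \<pi> c g) (c, g)"

text \<open>The supports obtained by solving a single-event problem. This is a set of supports because
  the optimum need neither exist (wealth zero is excluded, and \<open>U\<close> may have finite slope at zero)
  nor be unique (if the prices sum to one, holding all outcomes equally is the same as holding cash).\<close>

definition single_supports ::
  "(real \<Rightarrow> real) \<Rightarrow> nat \<Rightarrow> (nat \<Rightarrow> real) \<Rightarrow> (nat \<Rightarrow> real) \<Rightarrow> nat set set" where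
  "single_supports U N p \<pi> = {support N g | c g. single_optimal U N p \<pi> c g}"

end

theory Submission
  imports Defs
begin

text \<open>Freezing the holdings in the other events and averaging over them turns event \<open>l\<close> of the
  simultaneous problem into a single-event problem for another strictly concave utility. For any
  such utility, the first-order conditions at an optimum with cash say that the support consists of
  the outcomes whose ratio \<open>p / \<pi>\<close> exceeds a cutoff \<open>\<theta>\<close> (multiplier over marginal utility at the
  wealth of unheld outcomes), and that \<open>\<theta>\<close> solves an equation in which the utility no longer
  occurs. That equation has at most one positive solution unless the prices sum to one; in that case
  it has a continuum of solutions, but the resulting supports are all outcomes or those of
  non-minimal ratio, and both are attained by single-event optima.\<close>

section \<open>Consequences of strict concavity for an admissible utility\<close>

lemma admissible_utility_derivative:
  assumes "admissible_utility U" "0 < w"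
  shows "(U has_real_derivative deriv U w) (at w)"
proof -
  have "U C1_differentiable_on {0<..}"
    using assms(1) by (simp add: admissible_utility_def)
  then obtain D where "(U has_vector_derivative D w) (at w)"
    using assms(2) unfolding C1_differentiable_on_def by auto
  then have "(U has_real_derivative D w) (at w)"
    by (simp add: has_real_derivative_iff_has_vector_derivative)
  then show ?thesis
    by (simp add: DERIV_imp_deriv)
qed

lemma admissible_utility_deriv_pos:
  assumes "admissible_utility U" "0 < w"
  shows "deriv U w > 0"
  using assms by (simp add: admissible_utility_def)

text \<open>Concavity gives the weak tangent bound at the midpoint of \<open>x\<close> and
  \<open>y\<close>. Strict concavity puts \<open>U\<close> there strictly above the average of its
  end values, and combining the two makes the bound at \<open>y\<close> strict.\<close>

lemma admissible_utility_below_tangent: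
  assumes U: "admissible_utility U" and pos: "0 < x" "0 < y" and "x \<noteq> y"
  shows "U y < U x + deriv U x * (y - x)"
proof -
  have sc: "(1 - t) * U u + t * U v < U ((1 - t) * u + t * v)"
    if "0 < u" "0 < v" "u \<noteq> v" "0 < t" "t < 1" for u v t
    using U that unfolding admissible_utility_def strictly_concave_on_def by auto
  have cvx: "convex_on {0<..} (\<lambda>w. - U w)"
  proof (intro convex_onI)
    fix t u v :: real
    assume "0 < t" "t < 1" "u \<in> {0<..}" "v \<in> {0<..}"
    then show "- U ((1 - t) *\<^sub>R u + t *\<^sub>R v) \<le> (1 - t) * - U u + t * - U v"
      using sc[of u v t] by (cases "u = v") (auto simp: algebra_simps)
  qed simp
  define z where "z = (x + y) / 2"
  have "((\<lambda>w. - U w) has_real_derivative - deriv U x) (at x within {0<..})"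
    by (rule has_field_derivative_at_within[OF DERIV_minus[OF admissible_utility_derivative[OF U pos(1)]]])
  then have "- U z - - U x \<ge> - deriv U x * (z - x)"
    using pos by (intro convex_on_imp_above_tangent[OF cvx]) (auto simp: z_def interior_open)
  moreover have "(U x + U y) / 2 < U z"
    using sc[of x y "1 / 2"] pos \<open>x \<noteq> y\<close> by (simp add: z_def add_divide_distrib)
  moreover have "2 * (z - x) = y - x"
    by (simp add: z_def)
  ultimately show ?thesis
    by (simp add: z_def algebra_simps) argo
qed

lemma admissible_utility_deriv_strict_antimono:
  assumes "admissible_utility U" "0 < v" "v < w"
  shows "deriv U w < deriv U v"
proof -
  have "U w < U v + deriv U v * (w - v)" "U v < U w + deriv U w * (v - w)"
    using assms by (auto intro!: admissible_utility_below_tangent)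
  then have "deriv U w * (w - v) < deriv U v * (w - v)"
    by (simp add: algebra_simps)
  then show ?thesis
    using assms(3) by simp
qed

lemma admissible_utility_strict_mono:
  assumes "admissible_utility U" "0 < v" "v < w"
  shows "U v < U w"
proof -
  have "U v < U w + deriv U w * (v - w)"
    using assms by (intro admissible_utility_below_tangent) auto
  moreover have "deriv U w * (v - w) < 0"
    using assms admissible_utility_deriv_pos[of U w] by (simp add: mult_pos_neg)
  ultimately show ?thesis by simp
qed

section \<open>The cutoff equation and the uniqueness of its solutions\<close>

text \<open>With \<open>S\<close> the set of outcomes of ratio above \<open>\<theta>\<close>, the equation below reads
  \<open>\<theta> * (1 - sum \<pi> S) = 1 - sum p S\<close>. Its left-hand side is convex in \<open>\<theta>\<close>.\<close>

definition cutoff :: "nat \<Rightarrow> (nat \<Rightarrow> real) \<Rightarrow> (nat \<Rightarrow> real) \<Rightarrow> real \<Rightarrow> bool" where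
  "cutoff N p \<pi> \<theta> \<longleftrightarrow> \<theta> > 0 \<and> \<theta> + (\<Sum>i=1..N. max (p i - \<theta> * \<pi> i) 0) = 1"

text \<open>The positive parts vanish off \<open>S\<close>, and on \<open>S\<close> they equal their
  arguments. Solved for \<open>\<theta>\<close>, this identifies the quotient that bounds the first
  unheld ratio as the cutoff itself.\<close>

lemma cutoff_sum:
  assumes "cutoff N p \<pi> \<theta>" and \<pi>: "\<And>i. i \<in> {1..N} \<Longrightarrow> \<pi> i > 0"
    and S: "S = {i \<in> {1..N}. \<theta> < p i / \<pi> i}"
  shows "1 - sum p S = \<theta> * (1 - sum \<pi> S)"
proof -
  have "(\<Sum>i=1..N. max (p i - \<theta> * \<pi> i) 0) = (\<Sum>i\<in>S. p i - \<theta> * \<pi> i)"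
    using \<pi> by (intro sum.mono_neutral_cong_right) (auto simp: S max_def field_simps)
  then show ?thesis
    using assms(1) by (simp add: cutoff_def sum_subtractf sum_distrib_left algebra_simps)
qed

text \<open>Replacing each positive part by its argument can only decrease the sum. The bound
  ensures that selling equal amounts of all outcomes never lowers wealth.\<close>

lemma cutoff_imp_total_price_ge_1:
  assumes "cutoff N p \<pi> \<theta>" and "(\<Sum>i=1..N. p i) = 1"
  shows "(\<Sum>i=1..N. \<pi> i) \<ge> 1"
proof -
  have "(\<Sum>i=1..N. p i - \<theta> * \<pi> i) \<le> (\<Sum>i=1..N. max (p i - \<theta> * \<pi> i) 0)"
    by (intro sum_mono) auto
  then have "\<theta> * 1 \<le> \<theta> * (\<Sum>i=1..N. \<pi> i)"
    using assms by (simp add: cutoff_def sum_subtractf sum_distrib_left)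
  then show ?thesis
    using assms(1) by (simp add: cutoff_def)
qed

text \<open>The convex function \<open>\<theta> + (\<Sum>i=1..N. max (p i - \<theta> * \<pi> i) 0)\<close> takes the value 1 at
  \<open>0\<close>, so two cutoffs force every summand to be affine up to the larger one.\<close>

lemma two_cutoffs:
  assumes cut: "cutoff N p \<pi> \<theta>" "cutoff N p \<pi> \<eta>" and less: "\<theta> < \<eta>"
    and p: "(\<Sum>i=1..N. p i) = 1" "\<And>i. i \<in> {1..N} \<Longrightarrow> p i > 0"
    and \<pi>: "\<And>i. i \<in> {1..N} \<Longrightarrow> \<pi> i > 0"
  shows "(\<Sum>i=1..N. \<pi> i) = 1" and "\<And>i. i \<in> {1..N} \<Longrightarrow> \<eta> \<le> p i / \<pi> i"
proof -
  define a where "a i = max (p i - \<theta> * \<pi> i) 0" for i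
  \<comment> \<open>\<open>\<theta>\<close> lies between \<open>0\<close> and \<open>\<eta>\<close>
    with weight \<open>t\<close> on \<open>\<eta>\<close>. \<open>a i\<close> is the
    \<open>i\<close>-th summand at \<open>\<theta>\<close>, and \<open>b i\<close> is the value
    there of its chord over \<open>0\<close> and \<open>\<eta>\<close>; the summand at
    \<open>0\<close> is \<open>p i\<close>.\<close>
  define t where "t = \<theta> / \<eta>"
  define b where "b i = (1 - t) * p i + t * max (p i - \<eta> * \<pi> i) 0" for i
  have pos: "0 < \<theta>" "0 < \<eta>" and t: "0 < t" "t < 1" "\<theta> = t * \<eta>"
    using cut less by (auto simp: cutoff_def t_def)
  have le: "a i \<le> b i" if "i \<in> {1..N}" for i
  proof -
    have "b i \<ge> (1 - t) * p i + t * (p i - \<eta> * \<pi> i)"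
      unfolding b_def using t by (intro add_left_mono mult_left_mono) auto
    moreover have "b i \<ge> 0"
      unfolding b_def using t p(2)[OF that] by (intro add_nonneg_nonneg mult_nonneg_nonneg) auto
    ultimately show ?thesis
      by (simp add: a_def t algebra_simps)
  qed
  have "sum b {1..N} = (1 - t) + t * (1 - \<eta>)"
    using cut(2) p(1) by (simp add: b_def sum.distrib cutoff_def flip: sum_distrib_left)
  also have "\<dots> = sum a {1..N}"
    using cut(1) by (simp add: a_def cutoff_def t algebra_simps)
  finally have "sum a {1..N} = sum b {1..N}" ..
  \<comment> \<open>Termwise \<open>a\<close> is at most \<open>b\<close>, so equal sums force
    equality in every term.\<close>
  then have eq: "a i = b i" if "i \<in> {1..N}" for i
    using sum_mono_inv[of a "{1..N}" b i] le that by auto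
  show ge: "\<eta> \<le> p i / \<pi> i" if i: "i \<in> {1..N}" for i
  proof (rule ccontr)
    \<comment> \<open>The kink of the \<open>i\<close>-th summand would lie strictly before
      \<open>\<eta>\<close>, and the summand would be strictly below its chord at
      \<open>\<theta>\<close>.\<close>
    assume "\<not> ?thesis"
    then have *: "p i < \<eta> * \<pi> i"
      using \<pi>[OF i] by (simp add: field_simps)
    then have "b i = (1 - t) * p i"
      by (simp add: b_def)
    moreover have "0 < (1 - t) * p i"
      using t p(2)[OF i] by simp
    moreover have "p i - \<theta> * \<pi> i < (1 - t) * p i"
      using mult_strict_left_mono[OF * t(1)] by (simp add: t(3) algebra_simps)
    ultimately show False
      using eq[OF i] by (simp add: a_def)
  qed
  \<comment> \<open>With every positive part equal to its argument, the equation for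
    \<open>\<eta>\<close> reduces to \<open>\<eta>\<close> times the total price being
    \<open>\<eta>\<close>.\<close>
  have "(\<Sum>i=1..N. max (p i - \<eta> * \<pi> i) 0) = (\<Sum>i=1..N. p i - \<eta> * \<pi> i)"
    using ge \<pi> by (intro sum.cong max_absorb1) (auto simp: field_simps)
  then show "(\<Sum>i=1..N. \<pi> i) = 1"
    using cut(2) p(1) by (auto simp: cutoff_def sum_subtractf simp flip: sum_distrib_left)
qed

section \<open>First-order conditions and the elimination of the utility\<close>

text \<open>All first-order conditions needed come from trading one outcome against cash.\<close>

lemma optimal_support_is_cutoff:
  fixes V D :: "real \<Rightarrow> real" and p \<pi> g :: "nat \<Rightarrow> real"
  assumes V: "\<And>w. w > 0 \<Longrightarrow> (V has_real_derivative D w) (at w)"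
    and D_pos: "\<And>w. w > 0 \<Longrightarrow> D w > 0"
    and D_less: "\<And>v w. \<lbrakk>0 < v; v < w\<rbrakk> \<Longrightarrow> D w < D v"
    and p: "(\<Sum>i=1..N. p i) = 1" "\<And>i. i \<in> {1..N} \<Longrightarrow> p i > 0"
    and \<pi>: "\<And>i. i \<in> {1..N} \<Longrightarrow> \<pi> i > 0"
    and c: "c > 0" and g: "\<And>i. i \<in> {1..N} \<Longrightarrow> g i \<ge> 0"
    and opt: "\<And>c' g'. \<lbrakk>c' \<ge> 0; \<And>i. i \<in> {1..N} \<Longrightarrow> g' i \<ge> 0; \<And>i. i \<in> {1..N} \<Longrightarrow> c' + g' i > 0;
        c' + (\<Sum>i=1..N. \<pi> i * g' i) = c + (\<Sum>i=1..N. \<pi> i * g i)\<rbrakk> \<Longrightarrow>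
        (\<Sum>i=1..N. p i * V (c' + g' i)) \<le> (\<Sum>i=1..N. p i * V (c + g i))"
  obtains \<theta> where "cutoff N p \<pi> \<theta>" "support N g = {i \<in> {1..N}. \<theta> < p i / \<pi> i}"
proof -
  \<comment> \<open>The multiplier is the expected marginal utility, that is, the marginal value of
    cash.\<close>
  define \<mu> where "\<mu> = (\<Sum>i=1..N. p i * D (c + g i))"
  have wpos: "c + g i > 0" if "i \<in> {1..N}" for i
    using c g[OF that] by simp
  have "{1..N} \<noteq> {}"
    using p(1) by (cases N) auto
  then have \<mu>: "\<mu> > 0"
    unfolding \<mu>_def using p(2) D_pos wpos by (intro sum_pos) auto
  have foc: "p i * D (c + g i) \<le> \<mu> * \<pi> i" "g i > 0 \<Longrightarrow> p i * D (c + g i) = \<mu> * \<pi> i"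
    if i: "i \<in> {1..N}" for i
  proof -
    \<comment> \<open>\<open>\<phi> t\<close> is the expected utility after buying \<open>t\<close>
      units of outcome \<open>i\<close> with cash; negative \<open>t\<close> means selling.\<close>
    define e where "e j = (if j = i then 1 else 0 :: real)" for j
    define \<phi> where "\<phi> t = (\<Sum>j=1..N. p j * V ((c - \<pi> i * t) + (g j + t * e j)))" for t
    have "(\<phi> has_real_derivative (\<Sum>j=1..N. p j * (D (c + g j) * (e j - \<pi> i)))) (at 0)"
      unfolding \<phi>_def
    proof (intro DERIV_sum DERIV_cmult)
      fix j assume "j \<in> {1..N}"
      then have "(V has_real_derivative D (c + g j)) (at ((c - \<pi> i * 0) + (g j + 0 * e j)))"
        using V[OF wpos] by simp
      moreover have "((\<lambda>t. (c - \<pi> i * t) + (g j + t * e j)) has_real_derivative e j - \<pi> i) (at 0)"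
        by (auto intro!: derivative_eq_intros)
      ultimately show "((\<lambda>t. V ((c - \<pi> i * t) + (g j + t * e j)))
          has_real_derivative D (c + g j) * (e j - \<pi> i)) (at 0)"
        by (rule DERIV_chain2)
    qed
    moreover have "(\<Sum>j=1..N. p j * (D (c + g j) * (e j - \<pi> i))) = p i * D (c + g i) - \<mu> * \<pi> i"
    proof -
      have "(\<Sum>j=1..N. p j * (D (c + g j) * (e j - \<pi> i))) =
          (\<Sum>j=1..N. if j = i then p j * D (c + g j) else 0) - (\<Sum>j=1..N. p j * D (c + g j) * \<pi> i)"
        unfolding sum_subtractf[symmetric] by (intro sum.cong) (auto simp: e_def algebra_simps)
      then show ?thesis
        using i by (simp add: \<mu>_def sum_distrib_right)
    qed
    ultimately have der: "(\<phi> has_real_derivative p i * D (c + g i) - \<mu> * \<pi> i) (at 0)"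
      by simp
    have cost: "(\<Sum>j=1..N. \<pi> j * (g j + t * e j)) = (\<Sum>j=1..N. \<pi> j * g j) + \<pi> i * t" for t
    proof -
      have "(\<Sum>j=1..N. \<pi> j * (g j + t * e j)) =
          (\<Sum>j=1..N. \<pi> j * g j) + (\<Sum>j=1..N. if j = i then \<pi> j * t else 0)"
        unfolding sum.distrib[symmetric] by (intro sum.cong) (auto simp: e_def algebra_simps)
      then show ?thesis
        using i by simp
    qed
    \<comment> \<open>The upper bound on \<open>t\<close> keeps cash positive, the lower one keeps
      the holding of \<open>i\<close> nonnegative. Since \<open>c > 0\<close>, a small purchase is
      always possible; a small sale is possible only if \<open>g i > 0\<close>. Hence an inequality
      in general and an equality for held outcomes.\<close>
    have le: "\<phi> t \<le> \<phi> 0" if "t < c / \<pi> i" "- g i \<le> t" for t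
    proof -
      have cpos: "c - \<pi> i * t > 0"
        using that(1) \<pi>[OF i] by (simp add: field_simps)
      have gnn: "g j + t * e j \<ge> 0" if "j \<in> {1..N}" for j
        using g[OF that] \<open>- g i \<le> t\<close> by (simp add: e_def)
      show ?thesis
        unfolding \<phi>_def using opt[of "c - \<pi> i * t" "\<lambda>j. g j + t * e j", OF _ gnn, unfolded cost]
          cpos gnn by (simp add: add_pos_nonneg)
    qed
    have cdiv: "0 < c / \<pi> i"
      using c \<pi>[OF i] by simp
    show ineq: "p i * D (c + g i) \<le> \<mu> * \<pi> i"
    proof (rule ccontr)
      assume "\<not> ?thesis"
      then obtain d where "d > 0" "\<And>h. \<lbrakk>0 < h; h < d\<rbrakk> \<Longrightarrow> \<phi> 0 < \<phi> (0 + h)"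
        using DERIV_pos_inc_right[OF der] by auto
      moreover obtain h where "0 < h" "h < min d (c / \<pi> i)"
        using dense[of 0 "min d (c / \<pi> i)"] cdiv \<open>d > 0\<close> by auto
      ultimately have "\<phi> 0 < \<phi> h" "h < c / \<pi> i" "0 < h"
        by auto
      then show False
        using le[of h] g[OF i] by auto
    qed
    show "p i * D (c + g i) = \<mu> * \<pi> i" if gi: "g i > 0"
    proof -
      have "p i * D (c + g i) - \<mu> * \<pi> i = 0"
        using cdiv gi le
        by (intro DERIV_local_max[OF der, of "min (g i) (c / \<pi> i)"]) auto
      then show ?thesis by simp
    qed
  qed
  define \<theta> where "\<theta> = \<mu> / D c"
  have Dc: "D c > 0" "\<theta> * D c = \<mu>"
    using D_pos[OF c] by (auto simp: \<theta>_def)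
  \<comment> \<open>A held outcome has marginal utility strictly below \<open>D c\<close>, so its
    first-order equality forces a ratio strictly above \<open>\<theta>\<close>. In
    \<open>gap\<close>, the factor after \<open>D c\<close> is the minimum of \<open>p i\<close> and
    \<open>\<theta> * \<pi> i\<close>; summed over \<open>i\<close>, both sides become multiples of
    \<open>D c\<close>, which then cancels.\<close>
  have iff: "\<theta> < p i / \<pi> i \<longleftrightarrow> g i > 0"
    and gap: "p i * D (c + g i) = D c * (p i - max (p i - \<theta> * \<pi> i) 0)" if i: "i \<in> {1..N}" for i
  proof -
    have *: "\<theta> < p i / \<pi> i \<longleftrightarrow> \<mu> * \<pi> i < p i * D c"
      using Dc(1) \<pi>[OF i] by (simp add: \<theta>_def field_simps)
    have **: "\<mu> * \<pi> i < p i * D c" if "g i > 0"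
      using foc(2)[OF i that] D_less[of c "c + g i"] c that p(2)[OF i]
      by (metis less_add_same_cancel1 mult_strict_left_mono)
    have "p i * D c \<le> \<mu> * \<pi> i" if "\<not> g i > 0"
      using foc(1)[OF i] that g[OF i] by (simp add: not_less)
    then show iff: "\<theta> < p i / \<pi> i \<longleftrightarrow> g i > 0"
      using * ** by fastforce
    show "p i * D (c + g i) = D c * (p i - max (p i - \<theta> * \<pi> i) 0)"
    proof (cases "g i > 0")
      case True
      then have "p i - \<theta> * \<pi> i > 0"
        using iff \<pi>[OF i] by (simp add: field_simps)
      then show ?thesis
        using foc(2)[OF i True] Dc(2) by (simp add: algebra_simps)
    next
      case False
      then have "p i - \<theta> * \<pi> i \<le> 0" "g i = 0"
        using iff \<pi>[OF i] g[OF i] by (auto simp: field_simps)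
      then show ?thesis by simp
    qed
  qed
  have "\<mu> = (\<Sum>i=1..N. D c * (p i - max (p i - \<theta> * \<pi> i) 0))"
    unfolding \<mu>_def using gap by (intro sum.cong) auto
  then have "D c * \<theta> = D c * (1 - (\<Sum>i=1..N. max (p i - \<theta> * \<pi> i) 0))"
    using Dc(2) p(1) by (simp add: sum_subtractf mult.commute flip: sum_distrib_left)
  then have "\<theta> + (\<Sum>i=1..N. max (p i - \<theta> * \<pi> i) 0) = 1"
    using Dc(1) by simp
  moreover have "\<theta> > 0"
    using \<mu> Dc(1) by (simp add: \<theta>_def)
  ultimately have "cutoff N p \<pi> \<theta>"
    by (simp add: cutoff_def)
  then show thesis
    using that iff by (auto simp: support_def)
qed

section \<open>Single-event optima and supports given by a cutoff\<close>

lemma single_optimal_imp_feasible: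
  "single_optimal U N p \<pi> c g \<Longrightarrow> single_feasible N \<pi> c g"
  by (simp add: single_optimal_def is_arg_max_def)

lemma single_optimal_ge:
  assumes "single_optimal U N p \<pi> c g" "single_feasible N \<pi> c' g'"
  shows "(\<Sum>i=1..N. p i * U (c' + g' i)) \<le> (\<Sum>i=1..N. p i * U (c + g i))"
  using assms by (force simp: single_optimal_def is_arg_max_def not_less)

lemma single_optimal_support_is_cutoff:
  assumes U: "admissible_utility U"
    and p: "(\<Sum>i=1..N. p i) = 1" "\<And>i. i \<in> {1..N} \<Longrightarrow> p i > 0"
    and \<pi>: "\<And>i. i \<in> {1..N} \<Longrightarrow> \<pi> i > 0"
    and opt: "single_optimal U N p \<pi> c g" and c: "c > 0"
  obtains \<theta> where "cutoff N p \<pi> \<theta>" "support N g = {i \<in> {1..N}. \<theta> < p i / \<pi> i}"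
proof (rule optimal_support_is_cutoff[where V = U and D = "deriv U" and N = N and c = c and g = g])
  have feas: "single_feasible N \<pi> c g"
    by (rule single_optimal_imp_feasible[OF opt])
  then show "g i \<ge> 0" if "i \<in> {1..N}" for i
    using that by (simp add: single_feasible_def)
  show "(\<Sum>i=1..N. p i * U (c' + g' i)) \<le> (\<Sum>i=1..N. p i * U (c + g i))"
    if "c' \<ge> 0" "\<And>i. i \<in> {1..N} \<Longrightarrow> g' i \<ge> 0" "\<And>i. i \<in> {1..N} \<Longrightarrow> c' + g' i > 0"
      "c' + (\<Sum>i=1..N. \<pi> i * g' i) = c + (\<Sum>i=1..N. \<pi> i * g i)" for c' g'
    using that feas by (intro single_optimal_ge[OF opt]) (simp add: single_feasible_def)
qed (use admissible_utility_derivative[OF U] admissible_utility_deriv_pos[OF U]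
  admissible_utility_deriv_strict_antimono[OF U] p \<pi> c that in auto)

text \<open>Selling \<open>t\<close> units of every outcome changes wealth in every state by
  \<open>t\<close> times the excess of the total price over one. Negative \<open>t\<close>, a
  purchase, is allowed when this excess is zero.\<close>

lemma single_feasible_shift:
  assumes feas: "single_feasible N \<pi> c g" and total: "(\<Sum>i=1..N. \<pi> i) \<ge> 1"
    and c: "c + t * (\<Sum>i=1..N. \<pi> i) \<ge> 0" and t: "\<And>i. i \<in> {1..N} \<Longrightarrow> t \<le> g i"
    and nonneg: "t \<ge> 0 \<or> (\<Sum>i=1..N. \<pi> i) = 1"
  shows "single_feasible N \<pi> (c + t * (\<Sum>i=1..N. \<pi> i)) (\<lambda>i. g i - t)"
proof -
  have "t \<le> t * (\<Sum>i=1..N. \<pi> i)"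
    using nonneg total mult_left_mono[of 1 "\<Sum>i=1..N. \<pi> i" t] by auto
  then have "c + t * (\<Sum>i=1..N. \<pi> i) + (g i - t) > 0" if "i \<in> {1..N}" for i
    using feas that by (force simp: single_feasible_def)
  moreover have "(\<Sum>i=1..N. \<pi> i * (g i - t)) = (\<Sum>i=1..N. \<pi> i * g i) - t * (\<Sum>i=1..N. \<pi> i)"
    by (simp add: right_diff_distrib sum_subtractf sum_distrib_left mult.commute)
  ultimately show ?thesis
    using feas c t by (simp add: single_feasible_def)
qed

lemma single_optimal_of_ge:
  assumes "single_optimal U N p \<pi> c g" "single_feasible N \<pi> c' g'"
    and "(\<Sum>i=1..N. p i * U (c' + g' i)) \<ge> (\<Sum>i=1..N. p i * U (c + g i))"
  shows "single_optimal U N p \<pi> c' g'"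
  using assms by (force simp: single_optimal_def is_arg_max_def not_less)

text \<open>Selling the same number of units of every outcome does not lower the wealth when the prices
  sum to at least one; sell the least holding.\<close>

lemma single_optimal_normalise:
  assumes U: "admissible_utility U"
    and N: "N \<ge> 1" and p: "\<And>i. i \<in> {1..N} \<Longrightarrow> p i > 0"
    and total: "(\<Sum>i=1..N. \<pi> i) \<ge> 1"
    and opt: "single_optimal U N p \<pi> c g"
  obtains c' g' j where "single_optimal U N p \<pi> c' g'" "c' > 0" "j \<in> {1..N}" "g' j = 0"
    "(\<Sum>i=1..N. \<pi> i) \<noteq> 1 \<Longrightarrow> support N g' = support N g"
proof -
  define Q where "Q = (\<Sum>i=1..N. \<pi> i)"
  have feas: "single_feasible N \<pi> c g"
    by (rule single_optimal_imp_feasible[OF opt])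
  have ne: "finite (g ` {1..N})" "g ` {1..N} \<noteq> {}"
    using N by auto
  define t where "t = Min (g ` {1..N})"
  have "t \<in> g ` {1..N}"
    unfolding t_def by (rule Min_in[OF ne])
  then obtain j where j: "j \<in> {1..N}" "g j = t"
    by auto
  have t_le: "t \<le> g i" if "i \<in> {1..N}" for i
    unfolding t_def using that by auto
  have t_nn: "t \<ge> 0"
    using feas j by (auto simp: single_feasible_def)
  have tQ: "t \<le> t * Q"
    using t_nn total mult_left_mono[of 1 Q t] by (simp add: Q_def)
  have pos: "0 < c + g i" if "i \<in> {1..N}" for i
    using feas that by (simp add: single_feasible_def)
  \<comment> \<open>The old wealth at \<open>j\<close> was \<open>c + t\<close>, and the new cash is
    at least that.\<close>
  have cpos: "c + t * Q > 0"
    using pos[OF j(1)] tQ j(2) by simp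
  have feas': "single_feasible N \<pi> (c + t * Q) (\<lambda>i. g i - t)"
    unfolding Q_def using feas total cpos t_le t_nn
    by (intro single_feasible_shift) (auto simp: Q_def)
  have le: "p i * U (c + g i) \<le> p i * U (c + t * Q + (g i - t))" if i: "i \<in> {1..N}" for i
  proof (cases "t = t * Q")
    case False
    then have "c + g i < c + t * Q + (g i - t)"
      using tQ by linarith
    then show ?thesis
      using admissible_utility_strict_mono[OF U pos[OF i]] p[OF i] by (simp add: less_imp_le)
  next
    case True
    then have "c + t * Q + (g i - t) = c + g i"
      by linarith
    then show ?thesis
      by (simp only: order_refl)
  qed
  have opt': "single_optimal U N p \<pi> (c + t * Q) (\<lambda>i. g i - t)"
    by (intro single_optimal_of_ge[OF opt feas'] sum_mono le)
  \<comment> \<open>With \<open>Q > 1\<close>, selling a positive amount would strictly raise wealth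
    in every state, against optimality. So nothing was sold and the support is unchanged.\<close>
  have "t = 0" if "Q \<noteq> 1"
  proof (rule ccontr)
    assume "t \<noteq> 0"
    then have "t < t * Q"
      using tQ that by (metis mult_cancel_left2 order_le_neq_trans)
    then have "c + g i < c + t * Q + (g i - t)" for i
      by simp
    then have "p i * U (c + g i) < p i * U (c + t * Q + (g i - t))" if "i \<in> {1..N}" for i
      using admissible_utility_strict_mono[OF U pos[OF that]] p[OF that] by simp
    then have "(\<Sum>i=1..N. p i * U (c + g i)) < (\<Sum>i=1..N. p i * U (c + t * Q + (g i - t)))"
      using N by (intro sum_strict_mono) auto
    then show False
      using single_optimal_ge[OF opt feas'] by simp
  qed
  then show thesis
    using that[OF opt' cpos j(1)] j(2) by (auto simp: Q_def)
qed

text \<open>When the prices sum to one, spending half the cash on equal amounts of all outcomes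
  leaves wealth unchanged in every state, so optimality persists while every holding becomes
  positive.\<close>

lemma full_support_single_optimal:
  assumes total: "(\<Sum>i=1..N. \<pi> i) = 1" and opt: "single_optimal U N p \<pi> c g" and c: "c > 0"
  shows "{1..N} \<in> single_supports U N p \<pi>"
proof -
  have feas: "single_feasible N \<pi> c g"
    by (rule single_optimal_imp_feasible[OF opt])
  then have g: "g i \<ge> 0" if "i \<in> {1..N}" for i
    using that by (simp add: single_feasible_def)
  have "single_feasible N \<pi> (c + - (c / 2) * (\<Sum>i=1..N. \<pi> i)) (\<lambda>i. g i - - (c / 2))"
  proof (rule single_feasible_shift[OF feas])
    show "- (c / 2) \<le> g i" if "i \<in> {1..N}" for i
      using g[OF that] c by simp
  qed (simp_all only: total, use c in simp_all)
  then have "single_feasible N \<pi> (c / 2) (\<lambda>i. g i + c / 2)"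
    unfolding total by simp
  then have "single_optimal U N p \<pi> (c / 2) (\<lambda>i. g i + c / 2)"
  proof (rule single_optimal_of_ge[OF opt])
    have "c / 2 + (g i + c / 2) = c + g i" for i
      by simp
    then show "(\<Sum>i=1..N. p i * U (c + g i)) \<le> (\<Sum>i=1..N. p i * U (c / 2 + (g i + c / 2)))"
      by (simp only: order_refl)
  qed
  moreover have "support N (\<lambda>i. g i + c / 2) = {1..N}"
    using g c by (auto simp: support_def add_nonneg_pos)
  ultimately show ?thesis
    unfolding single_supports_def by blast
qed

text \<open>\<open>T\<close> witnesses that a single-event optimum exists; after normalisation it
  has cash and an unheld outcome \<open>j\<close>, hence a cutoff \<open>\<eta>\<close> that is at
  least the ratio of \<open>j\<close>. If \<open>S\<close> omits an outcome, or the total price is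
  not one, the two cutoffs agree. Otherwise \<open>S\<close> is the full set, which is attained by
  exchanging cash for equal holdings.\<close>

lemma cutoff_support_in_single_supports:
  assumes U: "admissible_utility U"
    and p: "(\<Sum>i=1..N. p i) = 1" "\<And>i. i \<in> {1..N} \<Longrightarrow> p i > 0"
    and \<pi>: "\<And>i. i \<in> {1..N} \<Longrightarrow> \<pi> i > 0"
    and cut: "cutoff N p \<pi> \<theta>" and S: "S = {i \<in> {1..N}. \<theta> < p i / \<pi> i}"
    and T: "T \<in> single_supports U N p \<pi>"
  shows "S \<in> single_supports U N p \<pi>" and "(\<Sum>i=1..N. \<pi> i) \<noteq> 1 \<Longrightarrow> T = S"
proof -
  have N: "N \<ge> 1"
    using p(1) by (cases N) auto
  have total: "(\<Sum>i=1..N. \<pi> i) \<ge> 1"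
    by (rule cutoff_imp_total_price_ge_1[OF cut p(1)])
  obtain c0 g0 where opt0: "single_optimal U N p \<pi> c0 g0" and T0: "T = support N g0"
    using T by (auto simp: single_supports_def)
  obtain c g j where opt: "single_optimal U N p \<pi> c g" and c: "c > 0"
    and j: "j \<in> {1..N}" "g j = 0"
    and supp: "(\<Sum>i=1..N. \<pi> i) \<noteq> 1 \<Longrightarrow> support N g = support N g0"
    using single_optimal_normalise[OF U N p(2) total opt0] by blast
  obtain \<eta> where cut': "cutoff N p \<pi> \<eta>" and S': "support N g = {i \<in> {1..N}. \<eta> < p i / \<pi> i}"
    using single_optimal_support_is_cutoff[OF U p \<pi> opt c] by blast
  note two = two_cutoffs[OF _ _ _ p \<pi>]
  have "j \<notin> support N g"
    using j by (simp add: support_def)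
  then have j_le: "p j / \<pi> j \<le> \<eta>"
    using S' j by auto
  \<comment> \<open>Distinct cutoffs would put every ratio at or above the larger one, yet
    \<open>\<theta>\<close> is at least the ratio of \<open>i\<close> and \<open>\<eta>\<close> at
    least that of \<open>j\<close>.\<close>
  have eq: "\<theta> = \<eta>" if "i \<in> {1..N}" "p i / \<pi> i \<le> \<theta>" for i
    using two(2)[OF cut cut', of i] two(2)[OF cut' cut, of j] that j(1) j_le
    by (cases \<theta> \<eta> rule: linorder_cases) auto
  show "S \<in> single_supports U N p \<pi>"
  proof (cases "S = {1..N}")
    case True
    show ?thesis
    proof (cases "(\<Sum>i=1..N. \<pi> i) = 1")
      case total1: True
      show ?thesis
        using full_support_single_optimal[OF total1 opt c] True by simp
    next
      case False
      then have "\<theta> = \<eta>"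
        using two(1)[OF cut cut'] two(1)[OF cut' cut] by (metis linorder_cases)
      then show ?thesis
        using S S' opt by (auto simp: single_supports_def)
    qed
  next
    case False
    then obtain i where "i \<in> {1..N}" "p i / \<pi> i \<le> \<theta>"
      using S by fastforce
    then have "\<theta> = \<eta>" by (rule eq)
    then show ?thesis
      using S S' opt by (auto simp: single_supports_def)
  qed
  show "T = S" if "(\<Sum>i=1..N. \<pi> i) \<noteq> 1"
  proof -
    have "\<theta> = \<eta>"
      using two(1)[OF cut cut'] two(1)[OF cut' cut] that by (metis linorder_cases)
    then show ?thesis
      using S S' T0 supp[OF that] by simp
  qed
qed

text \<open>Sorting makes the set of ratios above \<open>\<theta>\<close> an initial segment. The
  quotient in the bound equals \<open>\<theta>\<close>, and outcome \<open>k + 1\<close> has ratio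
  at most \<open>\<theta>\<close>.\<close>

lemma cutoff_support_initial_segment:
  assumes p: "(\<Sum>i=1..N. p i) = 1" "\<And>i. i \<in> {1..N} \<Longrightarrow> p i > 0"
    and \<pi>: "\<And>i. i \<in> {1..N} \<Longrightarrow> \<pi> i > 0"
    and cut: "cutoff N p \<pi> \<theta>"
    and sorted: "\<And>i j. \<lbrakk>i \<in> {1..N}; j \<in> {1..N}; i \<le> j\<rbrakk> \<Longrightarrow> p j / \<pi> j \<le> p i / \<pi> i"
  obtains k where "k \<in> {0..N}" "{i \<in> {1..N}. \<theta> < p i / \<pi> i} = {1..k}"
    "k < N \<Longrightarrow>
      p (k + 1) / \<pi> (k + 1) \<le> (1 - (\<Sum>i=1..k. p i)) / (1 - (\<Sum>i=1..k. \<pi> i))"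
proof -
  define S where "S = {i \<in> {1..N}. \<theta> < p i / \<pi> i}"
  \<comment> \<open>The inserted \<open>0\<close> covers an empty \<open>S\<close>, whose segment is
    \<open>{1..0}\<close>.\<close>
  define k where "k = Max (insert 0 S)"
  have fin: "finite (insert 0 S)"
    by (simp add: S_def)
  have k: "k = 0 \<or> k \<in> S"
    using Max_in[OF fin] by (auto simp: k_def)
  have S: "S = {1..k}"
  proof (intro equalityI subsetI)
    fix i assume "i \<in> S"
    then show "i \<in> {1..k}"
      using Max_ge[OF fin, of i] by (auto simp: k_def S_def)
  next
    fix i assume "i \<in> {1..k}"
    moreover from this have "k \<in> S"
      using k by auto
    ultimately show "i \<in> S"
      using sorted[of i k] by (force simp: S_def)
  qed
  have bound: "p (k + 1) / \<pi> (k + 1) \<le> (1 - (\<Sum>i=1..k. p i)) / (1 - (\<Sum>i=1..k. \<pi> i))" if "k < N"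
  proof -
    have eq: "1 - (\<Sum>i=1..k. p i) = \<theta> * (1 - (\<Sum>i=1..k. \<pi> i))"
      using cutoff_sum[OF cut \<pi> S_def] by (simp add: S)
    \<comment> \<open>Outcome \<open>k + 1\<close> has positive probability, so the numerator, and
      with it the denominator, is positive.\<close>
    have "(\<Sum>i=1..k. p i) < (\<Sum>i=1..N. p i)"
      using that p(2) by (intro sum_strict_mono2[of _ _ "k + 1"]) (auto simp: less_imp_le)
    then have "0 < \<theta> * (1 - (\<Sum>i=1..k. \<pi> i))"
      using eq p(1) by simp
    then have "1 - (\<Sum>i=1..k. \<pi> i) > 0"
      using cut by (simp add: cutoff_def zero_less_mult_iff)
    then have "(1 - (\<Sum>i=1..k. p i)) / (1 - (\<Sum>i=1..k. \<pi> i)) = \<theta>"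
      using eq by simp
    moreover have "k + 1 \<notin> S"
      using S by simp
    ultimately show ?thesis
      using that by (auto simp: S_def)
  qed
  show thesis
    using that[of k] k S bound by (auto simp: S_def)
qed

section \<open>Reduction of the simultaneous problem to one event\<close>

text \<open>The events \<open>E x\<close> partition the space and the integrand is constant on each;
  independence factorises their probabilities.\<close>

lemma (in prob_space) expectation_indep_finite:
  fixes f :: "('i \<Rightarrow> 'b) \<Rightarrow> real"
  assumes I: "finite I" "I \<noteq> {}" and A: "\<And>i. i \<in> I \<Longrightarrow> finite (A i)"
    and indep: "indep_vars (\<lambda>i. count_space (A i)) X I"
    and f: "\<And>x y. (\<And>i. i \<in> I \<Longrightarrow> x i = y i) \<Longrightarrow> f x = f y"
  shows "expectation (\<lambda>\<omega>. f (\<lambda>i. X i \<omega>)) =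
    (\<Sum>x\<in>PiE I A. (\<Prod>i\<in>I. prob {\<omega> \<in> space M. X i \<omega> = x i}) * f x)"
proof -
  define E where "E x = (\<Inter>i\<in>I. X i -` {x i} \<inter> space M)" for x
  have meas: "X i \<in> measurable M (count_space (A i))" if "i \<in> I" for i
    using indep that by (auto simp: indep_vars_def)
  have E_sets: "E x \<in> events" if "x \<in> PiE I A" for x
    unfolding E_def using I meas that by (intro sets.finite_INT) (auto intro!: measurable_sets)
  have E_prob: "prob (E x) = (\<Prod>i\<in>I. prob {\<omega> \<in> space M. X i \<omega> = x i})" if "x \<in> PiE I A" for x
  proof -
    have "prob (E x) = (\<Prod>i\<in>I. prob (X i -` {x i} \<inter> space M))"
      unfolding E_def using I that by (intro indep_varsD[OF indep]) auto
    then show ?thesis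
      by (simp add: vimage_def Int_def conj_commute)
  qed
  have fin: "finite (PiE I A)"
    using I A by (intro finite_PiE) auto
  have "f (\<lambda>i. X i \<omega>) = (\<Sum>x\<in>PiE I A. f x * indicator (E x) \<omega>)" if \<omega>: "\<omega> \<in> space M" for \<omega>
  proof -
    \<comment> \<open>Only the restricted tuple lies in \<open>PiE I A\<close>; \<open>f\<close>
      does not see the difference, as it depends only on coordinates in \<open>I\<close>.\<close>
    define y where "y = restrict (\<lambda>i. X i \<omega>) I"
    have y: "y \<in> PiE I A"
      using measurable_space[OF meas \<omega>] by (simp add: y_def PiE_iff)
    have "\<omega> \<in> E x \<longleftrightarrow> x = y" if "x \<in> PiE I A" for x
    proof
      assume "\<omega> \<in> E x"
      then show "x = y"
        using that y by (intro PiE_ext[OF that y]) (use I(2) in \<open>auto simp: E_def y_def\<close>)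
    next
      assume "x = y"
      then show "\<omega> \<in> E x"
        using \<omega> I(2) by (auto simp: E_def y_def)
    qed
    then have "(\<Sum>x\<in>PiE I A. f x * indicator (E x) \<omega>) = (\<Sum>x\<in>PiE I A. if x = y then f x else 0)"
      by (intro sum.cong) auto
    also have "\<dots> = f y"
      using fin y by simp
    also have "\<dots> = f (\<lambda>i. X i \<omega>)"
      by (rule f) (simp add: y_def)
    finally show ?thesis ..
  qed
  then have "expectation (\<lambda>\<omega>. f (\<lambda>i. X i \<omega>)) =
      expectation (\<lambda>\<omega>. \<Sum>x\<in>PiE I A. f x * indicator (E x) \<omega>)"
    by (intro Bochner_Integration.integral_cong) auto
  also have "\<dots> = (\<Sum>x\<in>PiE I A. expectation (\<lambda>\<omega>. f x * indicator (E x) \<omega>))"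
    using E_sets by (intro Bochner_Integration.integral_sum)
      (auto intro!: integrable_mult_right integrable_real_indicator simp: less_top[symmetric])
  also have "\<dots> = (\<Sum>x\<in>PiE I A. (\<Prod>i\<in>I. prob {\<omega> \<in> space M. X i \<omega> = x i}) * f x)"
    using E_sets E_prob sets.sets_into_space by (intro sum.cong) (auto simp: Int_absorb2 mult.commute)
  finally show ?thesis .
qed

lemma sum_PiE_remove:
  assumes "l \<in> I"
  shows "(\<Sum>x\<in>PiE I A. f x) = (\<Sum>i\<in>A l. \<Sum>y\<in>PiE (I - {l}) A. f (y(l := i)))"
proof -
  have "PiE I A = (\<lambda>(i, y). y(l := i)) ` (A l \<times> PiE (I - {l}) A)"
    using PiE_insert_eq[of l "I - {l}" A] assms by (simp add: insert_absorb)
  moreover have "inj_on (\<lambda>(i, y). y(l := i)) (A l \<times> PiE (I - {l}) A)"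
    using inj_combinator[of l "I - {l}" A] by simp
  ultimately have "(\<Sum>x\<in>PiE I A. f x) = (\<Sum>(i, y)\<in>A l \<times> PiE (I - {l}) A. f (y(l := i)))"
    by (simp add: sum.reindex case_prod_unfold comp_def)
  then show ?thesis
    by (simp add: sum.cartesian_product)
qed

text \<open>The argument \<open>w\<close> is the wealth from cash and event \<open>l\<close> alone.\<close>

definition averaged ::
  "nat \<Rightarrow> (nat \<Rightarrow> nat) \<Rightarrow> (nat \<Rightarrow> nat \<Rightarrow> real) \<Rightarrow> (nat \<Rightarrow> nat \<Rightarrow> real) \<Rightarrow> nat \<Rightarrow> (real \<Rightarrow> real) \<Rightarrow> real \<Rightarrow> real"
  where "averaged m n p g l F w =
    (\<Sum>y\<in>(\<Pi>\<^sub>E k\<in>{1..m} - {l}. {1..n k}).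
      (\<Prod>k\<in>{1..m} - {l}. p k (y k)) * F (w + (\<Sum>k\<in>{1..m} - {l}. g k (y k))))"

text \<open>Summing first over the other events separates off event \<open>l\<close>. Since
  \<open>averaged\<close> does not depend on row \<open>l\<close> of \<open>g\<close>, the update
  \<open>g(l := h)\<close> lets one averaged utility serve all portfolios that differ only in cash
  and in that row.\<close>

lemma expected_utility_averaged:
  assumes "prob_space M"
    and "prob_space.indep_vars M (\<lambda>l. count_space {1..n l}) X {1..m}"
    and distr: "\<And>l i. \<lbrakk>l \<in> {1..m}; i \<in> {1..n l}\<rbrakk> \<Longrightarrow> measure M {\<omega> \<in> space M. X l \<omega> = i} = p l i"
    and l: "l \<in> {1..m}"
  shows "expected_utility M X U m c (g(l := h)) =
    (\<Sum>i=1..n l. p l i * averaged m n p g l U (c + h i))"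
proof -
  interpret prob_space M by fact
  have "expected_utility M X U m c (g(l := h)) =
      (\<Sum>x\<in>(\<Pi>\<^sub>E k\<in>{1..m}. {1..n k}).
        (\<Prod>k\<in>{1..m}. prob {\<omega> \<in> space M. X k \<omega> = x k}) * U (wealth m c (g(l := h)) x))"
    unfolding expected_utility_def using assms(2) l
    by (intro expectation_indep_finite) (auto simp: wealth_def intro!: arg_cong[of _ _ U] sum.cong)
  also have "\<dots> = (\<Sum>x\<in>(\<Pi>\<^sub>E k\<in>{1..m}. {1..n k}).
        (\<Prod>k\<in>{1..m}. p k (x k)) * U (wealth m c (g(l := h)) x))"
    using distr by (intro sum.cong arg_cong2[of _ _ _ _ "(*)"] prod.cong) (auto simp: PiE_iff)
  also have "\<dots> = (\<Sum>i=1..n l. \<Sum>y\<in>(\<Pi>\<^sub>E k\<in>{1..m} - {l}. {1..n k}).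
        (\<Prod>k\<in>{1..m}. p k ((y(l := i)) k)) * U (wealth m c (g(l := h)) (y(l := i))))"
    by (rule sum_PiE_remove[OF l])
  also have "\<dots> = (\<Sum>i=1..n l. p l i * averaged m n p g l U (c + h i))"
    using l
    by (auto simp: averaged_def wealth_def sum_distrib_left prod.remove[of _ l] sum.remove[of _ l]
        algebra_simps intro!: sum.cong)
  finally show ?thesis .
qed

text \<open>Averaging shifted copies of \<open>U\<close> with positive weights and nonnegative
  shifts keeps the derivative positive and strictly decreasing, so the first-order analysis applies
  to the averaged utility.\<close>

lemma simultaneous_support_is_cutoff:
  assumes pp: "\<And>k i. \<lbrakk>k \<in> {1..m}; i \<in> {1..n k}\<rbrakk> \<Longrightarrow> p k i > 0"
    and p1: "\<And>k. k \<in> {1..m} \<Longrightarrow> (\<Sum>i=1..n k. p k i) = 1"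
    and \<pi>: "\<And>k i. \<lbrakk>k \<in> {1..m}; i \<in> {1..n k}\<rbrakk> \<Longrightarrow> \<pi> k i > 0"
    and U: "admissible_utility U"
    and M: "prob_space M" "prob_space.indep_vars M (\<lambda>l. count_space {1..n l}) X {1..m}"
    and distr: "\<And>k i. \<lbrakk>k \<in> {1..m}; i \<in> {1..n k}\<rbrakk> \<Longrightarrow> measure M {\<omega> \<in> space M. X k \<omega> = i} = p k i"
    and opt: "optimal M X U m n \<pi> c g" and c: "c > 0" and l: "l \<in> {1..m}"
  obtains \<theta> where "cutoff (n l) (p l) (\<pi> l) \<theta>"
    "support (n l) (g l) = {i \<in> {1..n l}. \<theta> < p l i / \<pi> l i}"
proof -
  define K where "K = {1..m} - {l}"
  define Y where "Y = (\<Pi>\<^sub>E k\<in>K. {1..n k})"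
  define q where "q y = (\<Prod>k\<in>K. p k (y k))" for y
  define s where "s y = (\<Sum>k\<in>K. g k (y k))" for y
  have avg: "averaged m n p g l F w = (\<Sum>y\<in>Y. q y * F (w + s y))" for F w
    by (simp add: averaged_def K_def Y_def q_def s_def)
  have feas: "feasible m n \<pi> c g"
    using opt by (simp add: optimal_def is_arg_max_def)
  then have g: "g k i \<ge> 0" if "k \<in> {1..m}" "i \<in> {1..n k}" for k i
    using that by (simp add: feasible_def)
  have Y: "finite Y" "Y \<noteq> {}"
  proof -
    \<comment> \<open>Probabilities summing to one exclude an event without outcomes, so the average
      is over a nonempty set.\<close>
    have "n k \<noteq> 0" if "k \<in> K" for k
      using p1[of k] that by (cases "n k") (auto simp: K_def)
    then show "finite Y" "Y \<noteq> {}"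
      unfolding Y_def by (auto simp: K_def PiE_eq_empty_iff Suc_le_eq intro!: finite_PiE)
  qed
  have q: "q y > 0" and s: "s y \<ge> 0" if "y \<in> Y" for y
  proof -
    have "k \<in> {1..m} \<and> y k \<in> {1..n k}" if "k \<in> K" for k
      using \<open>y \<in> Y\<close> that by (auto simp: Y_def K_def PiE_iff)
    then show "q y > 0" "s y \<ge> 0"
      unfolding q_def s_def using pp g by (simp_all add: prod_pos sum_nonneg)
  qed
  have wpos: "w + s y > 0" if "w > 0" "y \<in> Y" for w y
    using that s[OF that(2)] by simp
  \<comment> \<open>The spending on the other events is frozen, so competitors share the budget
    spent on cash and event \<open>l\<close> instead of budget one.\<close>
  have best: "(\<Sum>i=1..n l. p l i * averaged m n p g l U (c' + h i))
      \<le> (\<Sum>i=1..n l. p l i * averaged m n p g l U (c + g l i))"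
    if c': "c' \<ge> 0" and h: "\<And>i. i \<in> {1..n l} \<Longrightarrow> h i \<ge> 0"
      and pos: "\<And>i. i \<in> {1..n l} \<Longrightarrow> c' + h i > 0"
      and budget: "c' + (\<Sum>i=1..n l. \<pi> l i * h i) = c + (\<Sum>i=1..n l. \<pi> l i * g l i)" for c' h
  proof -
    have "feasible m n \<pi> c' (g(l := h))"
      unfolding feasible_def
    proof (intro conjI ballI)
      have "(\<Sum>k=1..m. \<Sum>i=1..n k. \<pi> k i * g k i) =
          (\<Sum>i=1..n l. \<pi> l i * g l i) + (\<Sum>k\<in>K. \<Sum>i=1..n k. \<pi> k i * g k i)"
        using l by (simp add: K_def sum.remove)
      moreover have "(\<Sum>k=1..m. \<Sum>i=1..n k. \<pi> k i * (g(l := h)) k i) =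
          (\<Sum>i=1..n l. \<pi> l i * h i) + (\<Sum>k\<in>K. \<Sum>i=1..n k. \<pi> k i * g k i)"
        using l by (simp add: K_def sum.remove)
      ultimately show "c' + (\<Sum>k=1..m. \<Sum>i=1..n k. \<pi> k i * (g(l := h)) k i) = 1"
        using budget feas by (simp add: feasible_def)
    next
      fix x assume x: "x \<in> (\<Pi>\<^sub>E k\<in>{1..m}. {1..n k})"
      have "wealth m c' (g(l := h)) x = (c' + h (x l)) + (\<Sum>k\<in>K. g k (x k))"
        using l by (simp add: wealth_def K_def sum.remove)
      moreover have "(\<Sum>k\<in>K. g k (x k)) \<ge> 0"
        using x g by (intro sum_nonneg) (auto simp: K_def PiE_iff)
      ultimately show "wealth m c' (g(l := h)) x > 0"
        using pos[of "x l"] x l by (auto simp: PiE_iff add_pos_nonneg)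
    qed (use c' h g in auto)
    \<comment> \<open>Writing \<open>g\<close> as \<open>g(l := g l)\<close> lets the averaged
      formula rewrite both sides.\<close>
    then have "expected_utility M X U m c' (g(l := h)) \<le> expected_utility M X U m c (g(l := g l))"
      using opt by (force simp: optimal_def is_arg_max_def not_less)
    then show ?thesis
      by (simp only: expected_utility_averaged[OF M distr l])
  qed
  show thesis
  proof (rule optimal_support_is_cutoff[where V = "averaged m n p g l U"
        and D = "averaged m n p g l (deriv U)" and N = "n l" and c = c and g = "g l"
        and p = "p l" and \<pi> = "\<pi> l"])
    fix w :: real assume w: "w > 0"
    have "((\<lambda>w. U (w + s y)) has_real_derivative deriv U (w + s y)) (at w)" if "y \<in> Y" for y
      using DERIV_shift[of U "deriv U (w + s y)" w "s y"]
        admissible_utility_derivative[OF U wpos[OF w that]] by simp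
    then show "(averaged m n p g l U has_real_derivative averaged m n p g l (deriv U) w) (at w)"
      unfolding avg by (intro DERIV_sum DERIV_cmult)
    show "averaged m n p g l (deriv U) w > 0"
      unfolding avg using Y q admissible_utility_deriv_pos[OF U wpos[OF w]]
      by (intro sum_pos mult_pos_pos) auto
  next
    fix v w :: real assume "0 < v" "v < w"
    then show "averaged m n p g l (deriv U) w < averaged m n p g l (deriv U) v"
      unfolding avg using Y q wpos admissible_utility_deriv_strict_antimono[OF U]
      by (intro sum_strict_mono mult_strict_left_mono) auto
  qed (fact p1[OF l] pp[OF l] \<pi>[OF l] c g[OF l] best that)+
qed

text \<open>A single-event optimum may fail to exist, so the comparison is conditional on
  \<open>single_supports\<close> being nonempty. When prices sum to one, cash and equal holdings of
  all outcomes are interchangeable, so the support need not be unique; hence the union is stated for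
  some choice of supports in general, and for every choice when no event has total price
  one.\<close>

theorem corollary4:
  fixes M :: "'a measure" and X :: "nat \<Rightarrow> 'a \<Rightarrow> nat"
    and m :: nat and n :: "nat \<Rightarrow> nat"
    and p \<pi> g :: "nat \<Rightarrow> nat \<Rightarrow> real" and c :: real
    and U :: "real \<Rightarrow> real"
  assumes "m \<ge> 1"
    and "\<forall>l\<in>{1..m}. \<forall>i\<in>{1..n l}. p l i > 0"
    and "\<forall>l\<in>{1..m}. (\<Sum>i=1..n l. p l i) = 1"
    and "\<forall>l\<in>{1..m}. \<forall>i\<in>{1..n l}. \<pi> l i > 0"
    and "admissible_utility U"
    and "prob_space M"
    and "prob_space.indep_vars M (\<lambda>l. count_space {1..n l}) X {1..m}"
    and "\<forall>l\<in>{1..m}. \<forall>i\<in>{1..n l}. measure M {\<omega> \<in> space M. X l \<omega> = i} = p l i"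
    and "\<forall>l\<in>{1..m}. \<forall>i\<in>{1..n l}. \<forall>j\<in>{1..n l}. i \<le> j \<longrightarrow> p l j / \<pi> l j \<le> p l i / \<pi> l i"
    and "optimal M X U m n \<pi> c g"
    and "c > 0"
  shows
    "(\<forall>l\<in>{1..m}. \<exists>k\<in>{0..n l}.
        (\<forall>i\<in>{1..n l}. i \<le> k \<longrightarrow> g l i > 0) \<and>
        (\<forall>i\<in>{1..n l}. i > k \<longrightarrow> g l i = 0) \<and>
        (k < n l \<longrightarrow>
           p l (k + 1) / \<pi> l (k + 1) \<le> (1 - (\<Sum>i=1..k. p l i)) / (1 - (\<Sum>i=1..k. \<pi> l i)))) \<and>
     (\<forall>l\<in>{1..m}. single_supports U (n l) (p l) (\<pi> l) \<noteq> {} \<longrightarrow>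
        support (n l) (g l) \<in> single_supports U (n l) (p l) (\<pi> l) \<and>
        ((\<Sum>i=1..n l. \<pi> l i) \<noteq> 1 \<longrightarrow>
           single_supports U (n l) (p l) (\<pi> l) = {support (n l) (g l)})) \<and>
     ((\<forall>l\<in>{1..m}. single_supports U (n l) (p l) (\<pi> l) \<noteq> {}) \<longrightarrow>
        (\<exists>S. (\<forall>l\<in>{1..m}. S l \<in> single_supports U (n l) (p l) (\<pi> l)) \<and>
           {(l, i). l \<in> {1..m} \<and> i \<in> {1..n l} \<and> g l i > 0} = (\<Union>l\<in>{1..m}. {l} \<times> S l))) \<and>
     (\<forall>S. (\<forall>l\<in>{1..m}. (\<Sum>i=1..n l. \<pi> l i) \<noteq> 1 \<and>
             S l \<in> single_supports U (n l) (p l) (\<pi> l)) \<longrightarrow>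
        {(l, i). l \<in> {1..m} \<and> i \<in> {1..n l} \<and> g l i > 0} = (\<Union>l\<in>{1..m}. {l} \<times> S l))"
proof -
  have main: "\<exists>\<theta>. cutoff (n l) (p l) (\<pi> l) \<theta> \<and>
      support (n l) (g l) = {i \<in> {1..n l}. \<theta> < p l i / \<pi> l i}" if "l \<in> {1..m}" for l
    by (rule simultaneous_support_is_cutoff[OF _ _ _ assms(5,6,7) _ assms(10,11) that])
      (use assms(2,3,4,8) in blast)+
  have p1: "(\<Sum>i=1..n l. p l i) = 1"
    and pp: "\<And>i. i \<in> {1..n l} \<Longrightarrow> p l i > 0" and \<pi>: "\<And>i. i \<in> {1..n l} \<Longrightarrow> \<pi> l i > 0"
    and sorted: "\<And>i j. \<lbrakk>i \<in> {1..n l}; j \<in> {1..n l}; i \<le> j\<rbrakk> \<Longrightarrow> p l j / \<pi> l j \<le> p l i / \<pi> l i"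
    if "l \<in> {1..m}" for l
    using assms(2,3,4,9) that by blast+
  have segment: "\<exists>k\<in>{0..n l}.
        (\<forall>i\<in>{1..n l}. i \<le> k \<longrightarrow> g l i > 0) \<and>
        (\<forall>i\<in>{1..n l}. i > k \<longrightarrow> g l i = 0) \<and>
        (k < n l \<longrightarrow>
           p l (k + 1) / \<pi> l (k + 1) \<le> (1 - (\<Sum>i=1..k. p l i)) / (1 - (\<Sum>i=1..k. \<pi> l i)))"
    if l: "l \<in> {1..m}" for l
  proof -
    obtain \<theta> where cut: "cutoff (n l) (p l) (\<pi> l) \<theta>"
      and supp: "support (n l) (g l) = {i \<in> {1..n l}. \<theta> < p l i / \<pi> l i}"
      using main[OF l] by blast
    obtain k where k: "k \<in> {0..n l}" "{i \<in> {1..n l}. \<theta> < p l i / \<pi> l i} = {1..k}"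
      "k < n l \<longrightarrow>
        p l (k + 1) / \<pi> l (k + 1) \<le> (1 - (\<Sum>i=1..k. p l i)) / (1 - (\<Sum>i=1..k. \<pi> l i))"
      using cutoff_support_initial_segment[OF p1[OF l] pp[OF l] \<pi>[OF l] cut sorted[OF l]] by blast
    have "feasible m n \<pi> c g"
      using assms(10) by (simp add: optimal_def is_arg_max_def)
    then have nonneg: "g l i \<ge> 0" if "i \<in> {1..n l}" for i
      using l that by (simp add: feasible_def)
    have mem: "g l i > 0 \<longleftrightarrow> i \<le> k" if "i \<in> {1..n l}" for i
    proof -
      have "g l i > 0 \<longleftrightarrow> i \<in> support (n l) (g l)"
        using that by (simp add: support_def)
      also have "\<dots> \<longleftrightarrow> i \<le> k"
        using that unfolding supp k(2) by simp
      finally show ?thesis .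
    qed
    have "g l i = 0" if "i \<in> {1..n l}" "i > k" for i
      using mem[OF that(1)] nonneg[OF that(1)] that(2) by linarith
    then show ?thesis
      using k(1,3) mem by blast
  qed
  have single: "support (n l) (g l) \<in> single_supports U (n l) (p l) (\<pi> l)"
    "(\<Sum>i=1..n l. \<pi> l i) \<noteq> 1 \<Longrightarrow> T = support (n l) (g l)"
    if l: "l \<in> {1..m}" and T: "T \<in> single_supports U (n l) (p l) (\<pi> l)" for l T
  proof -
    obtain \<theta> where cut: "cutoff (n l) (p l) (\<pi> l) \<theta>"
      and supp: "support (n l) (g l) = {i \<in> {1..n l}. \<theta> < p l i / \<pi> l i}"
      using main[OF l] by blast
    note * = cutoff_support_in_single_supports[OF assms(5) p1[OF l] pp[OF l] \<pi>[OF l] cut supp T]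
    show "support (n l) (g l) \<in> single_supports U (n l) (p l) (\<pi> l)"
      by (rule *(1))
    show "T = support (n l) (g l)" if "(\<Sum>i=1..n l. \<pi> l i) \<noteq> 1"
      using *(2)[OF _ _ that] .
  qed
  have union: "{(l, i). l \<in> {1..m} \<and> i \<in> {1..n l} \<and> g l i > 0} = (\<Union>l\<in>{1..m}. {l} \<times> S l)"
    if "\<And>l. l \<in> {1..m} \<Longrightarrow> S l = support (n l) (g l)" for S
    using that by (auto simp: support_def)
  show ?thesis
  proof (intro conjI)
    show "\<forall>l\<in>{1..m}. single_supports U (n l) (p l) (\<pi> l) \<noteq> {} \<longrightarrow>
        support (n l) (g l) \<in> single_supports U (n l) (p l) (\<pi> l) \<and>
        ((\<Sum>i=1..n l. \<pi> l i) \<noteq> 1 \<longrightarrow>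
           single_supports U (n l) (p l) (\<pi> l) = {support (n l) (g l)})"
      using single by blast
    show "(\<forall>l\<in>{1..m}. single_supports U (n l) (p l) (\<pi> l) \<noteq> {}) \<longrightarrow>
        (\<exists>S. (\<forall>l\<in>{1..m}. S l \<in> single_supports U (n l) (p l) (\<pi> l)) \<and>
           {(l, i). l \<in> {1..m} \<and> i \<in> {1..n l} \<and> g l i > 0} = (\<Union>l\<in>{1..m}. {l} \<times> S l))"
    \<comment> \<open>The family left open by \<open>exI\<close> becomes that of the simultaneous
      supports.\<close>
    proof (intro impI exI conjI ballI)
      fix l assume "\<forall>l\<in>{1..m}. single_supports U (n l) (p l) (\<pi> l) \<noteq> {}" and l: "l \<in> {1..m}"
      then obtain T where "T \<in> single_supports U (n l) (p l) (\<pi> l)"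
        by blast
      then show "support (n l) (g l) \<in> single_supports U (n l) (p l) (\<pi> l)"
        by (rule single(1)[OF l])
    qed (rule union[OF refl])
    show "\<forall>S. (\<forall>l\<in>{1..m}. (\<Sum>i=1..n l. \<pi> l i) \<noteq> 1 \<and>
             S l \<in> single_supports U (n l) (p l) (\<pi> l)) \<longrightarrow>
        {(l, i). l \<in> {1..m} \<and> i \<in> {1..n l} \<and> g l i > 0} = (\<Union>l\<in>{1..m}. {l} \<times> S l)"
    proof (intro allI impI union)
      fix S l
      assume "\<forall>l\<in>{1..m}. (\<Sum>i=1..n l. \<pi> l i) \<noteq> 1 \<and>
             S l \<in> single_supports U (n l) (p l) (\<pi> l)" and l: "l \<in> {1..m}"
      then show "S l = support (n l) (g l)"
        by (intro single(2)[OF l]) blast+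
    qed
    show "\<forall>l\<in>{1..m}. \<exists>k\<in>{0..n l}.
        (\<forall>i\<in>{1..n l}. i \<le> k \<longrightarrow> g l i > 0) \<and>
        (\<forall>i\<in>{1..n l}. i > k \<longrightarrow> g l i = 0) \<and>
        (k < n l \<longrightarrow>
           p l (k + 1) / \<pi> l (k + 1) \<le> (1 - (\<Sum>i=1..k. p l i)) / (1 - (\<Sum>i=1..k. \<pi> l i)))"
      using segment by (rule ballI)
  qed
qed

end
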